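(* Let $\alpha>0$, $a>0$ and $a<T\le+\infty$. Let $u$ be a nonnegative function locally integrable on $[a,T)$, let $\psi$ be a nonnegative, nondecreasing continuous function on $[a,T)$ with $\psi(t)\le C$ for some constant $C$, and let $v$ be nonnegative and locally integrable on $[a,T)$ with $$v(t)\le u(t)+\psi(t)\int_a^t\Big(\log\frac{t}{\tau}\Big)^{\alpha-1}\frac{v(\tau)}{\tau}\,d\tau,\qquad t\in[a,T).$$ Then $$v(t)\le u(t)+\int_a^t\left[\sum_{k=1}^{\infty}\frac{(\psi(t)\Gamma(\alpha))^{k}}{\Gamma(k\alpha)}\Big(\log\frac{t}{\tau}\Big)^{k\alpha-1}\frac{u(\tau)}{\tau}\right]d\tau,\qquad t\in[a,T).$$
   Context: $\log$ is the natural logarithm and $\Gamma$ is the Euler Gamma function. Integrals of nonnegative functions may take the value $+\infty$. *)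

theory Defs
  imports "HOL-Analysis.Analysis"
begin

definition locally_integrable_on :: "(real \<Rightarrow> real) \<Rightarrow> real set \<Rightarrow> bool"
    (infixr "locally'_integrable'_on" 46) where
  "f locally_integrable_on S \<longleftrightarrow>
     (\<forall>K. compact K \<and> K \<subseteq> S \<longrightarrow> f absolutely_integrable_on K)"

end

theory Submission
  imports Defs
begin

text \<open>
  Fix \<open>t\<close> and put \<open>x = \<psi> t * Gamma \<alpha>\<close>. As \<open>\<psi>\<close> is nondecreasing, \<open>v \<le> u + x * K\<^sub>\<alpha> v\<close> on \<open>[a, t]\<close>, where
  \<open>K\<^sub>p\<close> is the Hadamard fractional integral of order \<open>p\<close>. The \<open>K\<^sub>p\<close> form a semigroup, so iterating
  gives \<open>v \<le> u + x * K\<^sub>\<alpha> u + \<dots> + x ^ n * K\<^bsub>n\<alpha>\<^esub> u + x ^ (n + 1) * K\<^bsub>(n + 1)\<alpha>\<^esub> v\<close>. The remainder tends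
  to zero at \<open>t\<close> because its kernel is eventually bounded and \<open>Gamma (n * \<alpha>)\<close> grows faster than any
  power \<open>y ^ n\<close>.
\<close>

section \<open>Hadamard kernels and their semigroup law\<close>

text \<open>Dividing by \<open>Gamma p\<close> makes composition add the orders with no constant
  left over. The built-in cutoff lets every integral run over the whole line, and values in
  \<open>ennreal\<close> allow Tonelli without integrability checks.\<close>

definition log_kernel :: "real \<Rightarrow> real \<Rightarrow> real \<Rightarrow> ennreal" where
  "log_kernel p t s =
     (if 0 < s \<and> s < t then ennreal (ln (t / s) powr (p - 1) / (Gamma p * s)) else 0)"

lemma borel_measurable_log_kernel [measurable (raw)]:
  assumes [measurable]: "f \<in> borel_measurable M" "g \<in> borel_measurable M"
  shows "(\<lambda>x. log_kernel p (f x) (g x)) \<in> borel_measurable M"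
  unfolding log_kernel_def by measurable

text \<open>The substitution \<open>s = r * (t / r) powr x\<close> turns the left-hand side into a Beta integral.\<close>

lemma nn_integral_log_kernel_mult:
  assumes p: "p > 0" and q: "q > 0"
  shows "(\<integral>\<^sup>+s. log_kernel p t s * log_kernel q s r \<partial>lborel) = log_kernel (p + q) t r"
proof (cases "0 < r \<and> r < t")
  case False
  then have "(\<lambda>s. log_kernel p t s * log_kernel q s r) = (\<lambda>s. 0)"
    by (auto simp: log_kernel_def fun_eq_iff)
  moreover have "log_kernel (p + q) t r = 0" using False by (auto simp: log_kernel_def)
  ultimately show ?thesis by simp
next
  case True
  define L where "L = ln (t / r)"
  have L: "L > 0" using True by (simp add: L_def)
  \<comment> \<open>\<open>g\<close> increases from \<open>r\<close> to \<open>t\<close> on [0, 1],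
    with \<open>ln (g x / r) = x * L\<close>, \<open>ln (t / g x) = (1 - x) * L\<close> and
    derivative \<open>L * g x\<close>.\<close>
  define g where "g x = r * exp (x * L)" for x
  have g0: "g 0 = r" and g1: "g 1 = t"
    using True by (simp_all add: g_def L_def)
  have gp: "g x > 0" for x using True by (simp add: g_def)
  have Gp: "Gamma p > 0" "Gamma q > 0" "Gamma (p + q) > 0"
    using p q by (simp_all add: Gamma_real_pos)
  \<comment> \<open>The exponent of \<open>L\<close> collects p - 1 and q - 1 from the two kernels
    and 1 from the derivative of \<open>g\<close>.\<close>
  define c where "c = L powr (p + q - 1) / (Gamma p * Gamma q * r)"
  have c: "c \<ge> 0" using Gp True by (simp add: c_def)
  have pt: "log_kernel p t (g x) * log_kernel q (g x) r * ennreal (L * g x) =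
      ennreal c * ennreal (x powr (q - 1) * (1 - x) powr (p - 1))"
    if x: "x \<in> {0..1}" for x
  \<comment> \<open>At the endpoints both sides vanish: the cutoff in the kernel is strict, and
    \<open>0 powr y\<close> is 0 for every \<open>y\<close>.\<close>
  proof (cases "x = 0 \<or> x = 1")
    case True
    then show ?thesis using g0 g1 by (auto simp: log_kernel_def)
  next
    case False
    then have x01: "0 < x" "x < 1" using x by auto
    have l1: "ln (t / g x) = (1 - x) * L"
    proof -
      have "ln (t / g x) = ln (t / r) - x * L"
        using \<open>0 < r \<and> r < t\<close> by (simp add: g_def ln_div ln_mult)
      then show ?thesis by (simp add: L_def algebra_simps)
    qed
    have l2: "ln (g x / r) = x * L"
      using \<open>0 < r \<and> r < t\<close> by (simp add: g_def)
    have "g 0 < g x" "g x < g 1"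
      using x01 L \<open>0 < r \<and> r < t\<close> by (simp_all add: g_def)
    then have b: "r < g x" "g x < t" by (simp_all add: g0 g1)
    have "L powr (p + q - 1) = L powr (p - 1) * L powr (q - 1) * L"
      using L by (simp add: powr_add[symmetric] powr_mult_base mult.commute)
    moreover have "((1 - x) * L) powr (p - 1) = (1 - x) powr (p - 1) * L powr (p - 1)"
      "(x * L) powr (q - 1) = x powr (q - 1) * L powr (q - 1)"
      using L x01 by (simp_all add: powr_mult)
    ultimately have e: "((1 - x) * L) powr (p - 1) / (Gamma p * g x) * ((x * L) powr (q - 1) / (Gamma q * r)) * (L * g x)
        = c * (x powr (q - 1) * (1 - x) powr (p - 1))"
      using L x01 gp[of x] Gp \<open>0 < r \<and> r < t\<close>
      by (simp add: c_def mult_ac)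
    have "log_kernel p t (g x) * log_kernel q (g x) r * ennreal (L * g x)
        = ennreal (((1 - x) * L) powr (p - 1) / (Gamma p * g x)) *
          ennreal ((x * L) powr (q - 1) / (Gamma q * r)) * ennreal (L * g x)"
      using b True gp[of x] \<open>0 < r \<and> r < t\<close> by (simp add: log_kernel_def l1 l2)
    also have "\<dots> = ennreal (c * (x powr (q - 1) * (1 - x) powr (p - 1)))"
      unfolding e[symmetric] using Gp gp[of x] L \<open>0 < r \<and> r < t\<close>
      by (simp add: ennreal_mult[symmetric])
    finally show ?thesis using c by (simp add: ennreal_mult)
  qed
  have "(\<integral>\<^sup>+s. log_kernel p t s * log_kernel q s r \<partial>lborel) =
      (\<integral>\<^sup>+s. log_kernel p t s * log_kernel q s r * indicator {g 0..g 1} s \<partial>lborel)"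
    unfolding g0 g1
    by (intro nn_integral_cong) (auto simp: log_kernel_def indicator_def)
  also have "\<dots> = (\<integral>\<^sup>+x. log_kernel p t (g x) * log_kernel q (g x) r * ennreal (L * g x) * indicator {0..1} x \<partial>lborel)"
    using L True
    by (intro nn_integral_substitution_aux)
       (auto simp: g_def intro!: derivative_eq_intros continuous_intros)
  also have "\<dots> = (\<integral>\<^sup>+x. ennreal c * (ennreal (x powr (q - 1) * (1 - x) powr (p - 1)) * indicator {0..1} x) \<partial>lborel)"
    using pt by (intro nn_integral_cong) (auto simp: indicator_def)
  also have "\<dots> = ennreal c * ennreal (Beta q p)"
    using nn_integral_has_integral_lebesgue'[OF _ has_integral_Beta_real[OF q p]]
    by (subst nn_integral_cmult) auto
  \<comment> \<open>Since \<open>Beta q p\<close> is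
    \<open>Gamma q * Gamma p / Gamma (q + p)\<close>, the two normalising factors cancel and that of
    order \<open>p + q\<close> appears.\<close>
  also have "\<dots> = ennreal (L powr (p + q - 1) / (Gamma (p + q) * r))"
    using Gp c True by (simp add: ennreal_mult'[symmetric] c_def Beta_def add.commute)
  finally show ?thesis using True by (simp add: log_kernel_def L_def)
qed

section \<open>Growth of Gamma and decay of the remainder\<close>

text \<open>Keep only the part of Euler's integral over [M, M + 1], where each factor of the
  integrand is at least its bound at one endpoint. As \<open>M\<close> is arbitrary, Gamma outgrows
  every geometric sequence.\<close>

lemma Gamma_ge_powr:
  fixes z M :: real
  assumes "z \<ge> 1" "M > 0"
  shows "Gamma z \<ge> M powr (z - 1) * exp (- (M + 1))"
proof -
  have i: "((\<lambda>t. t powr (z - 1) / exp t) has_integral Gamma z) {0..}"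
    using assms by (intro Gamma_integral_real) auto
  have "((\<lambda>t. if t \<in> {M..M+1} then M powr (z - 1) * exp (- (M + 1)) else 0) has_integral
      M powr (z - 1) * exp (- (M + 1))) {0..}"
    using has_integral_const_real[of "M powr (z - 1) * exp (- (M + 1))" M "M + 1"] assms
    by (subst has_integral_restrict) auto
  then show ?thesis
  proof (rule has_integral_le[OF _ i])
    fix s :: real assume "s \<in> {0..}"
    have "M powr (z - 1) * exp (- (M + 1)) \<le> s powr (z - 1) * exp (- s)" if "s \<in> {M..M+1}"
      using that assms by (intro mult_mono powr_mono2) auto
    then show "(if s \<in> {M..M+1} then M powr (z - 1) * exp (- (M + 1)) else 0) \<le> s powr (z - 1) / exp s"
      by (auto simp: exp_minus divide_inverse)
  qed
qed

lemma power_over_Gamma_tendsto_0: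
  fixes x \<alpha> :: real
  assumes \<alpha>: "\<alpha> > 0" and x: "x \<ge> 0"
  shows "(\<lambda>n. x ^ n / Gamma (real n * \<alpha>)) \<longlonglongrightarrow> 0"
proof -
  \<comment> \<open>With \<open>M powr \<alpha> = 2 * x + 1\<close> the quotient is dominated by
    powers of x / (2 * x + 1), which is at most 1/2; the summand 1 keeps the base positive when
    \<open>x = 0\<close>.\<close>
  define M where "M = (2 * x + 1) powr (1 / \<alpha>)"
  have M: "M > 0" using x by (simp add: M_def)
  have M\<alpha>: "M powr \<alpha> = 2 * x + 1" using \<alpha> x by (simp add: M_def powr_powr)
  \<comment> \<open>The factor \<open>M\<close> in \<open>D\<close> makes up for the exponent z - 1
    in \<open>Gamma_ge_powr\<close>, and the exponential is the one lost there.\<close>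
  define D where "D = M * exp (M + 1)"
  have ev: "eventually (\<lambda>n. norm (x ^ n / Gamma (real n * \<alpha>)) \<le> D * (1 / 2) ^ n) sequentially"
    using eventually_ge_at_top[of "nat \<lceil>1 / \<alpha>\<rceil>"]
  proof eventually_elim
    case (elim n)
    have "1 / \<alpha> \<le> real n" using elim by linarith
    then have n: "real n * \<alpha> \<ge> 1" using \<alpha> by (simp add: field_simps)
    have "M powr (real n * \<alpha>) = (2 * x + 1) ^ n"
      using M x by (simp add: M\<alpha>[symmetric] powr_powr[symmetric] powr_realpow mult.commute[of _ \<alpha>])
    then have "M powr (real n * \<alpha> - 1) * exp (- (M + 1)) = (2 * x + 1) ^ n / D"
      using M by (simp add: powr_diff D_def exp_minus[of "M + 1"] divide_inverse del: minus_add_distrib)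
    then have G: "Gamma (real n * \<alpha>) \<ge> (2 * x + 1) ^ n / D"
      using Gamma_ge_powr[OF n M] by simp
    have Dp: "D > 0" using M by (simp add: D_def)
    have "x ^ n / Gamma (real n * \<alpha>) \<le> x ^ n / ((2 * x + 1) ^ n / D)"
      using x Dp G by (intro divide_left_mono) (auto intro!: mult_pos_pos divide_pos_pos less_le_trans[OF _ G])
    also have "\<dots> = D * (x / (2 * x + 1)) ^ n"
      by (simp add: power_divide)
    also have "\<dots> \<le> D * (1 / 2) ^ n"
      using x Dp by (intro mult_left_mono power_mono) (auto simp: field_simps)
    finally show ?case using x n by (simp add: Gamma_real_pos)
  qed
  have "(\<lambda>n. D * (1 / 2) ^ n) \<longlonglongrightarrow> D * 0"
    by (intro tendsto_intros) auto
  then show ?thesis using Lim_null_comparison[OF ev] by simp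
qed

text \<open>Once \<open>real n * \<alpha>\<close> is at least 1, the kernel is no longer singular at
  \<open>t\<close> and is bounded on (a, t) by replacing \<open>s\<close> with \<open>a\<close>.
  What remains is that bound times the finite integral of \<open>V\<close>.\<close>

lemma log_kernel_integral_tendsto_0:
  fixes V :: "real \<Rightarrow> ennreal"
  assumes \<alpha>: "\<alpha> > 0" and a: "0 < a" "a < t" and x: "x \<ge> 0"
    and V [measurable]: "V \<in> borel_measurable borel" and fin: "(\<integral>\<^sup>+s. V s \<partial>lborel) < \<infinity>"
    and V0: "\<And>s. s \<le> a \<Longrightarrow> V s = 0"
  shows "(\<lambda>n. ennreal (x ^ n) * (\<integral>\<^sup>+s. log_kernel (real n * \<alpha>) t s * V s \<partial>lborel)) \<longlonglongrightarrow> 0"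
proof -
  define L where "L = ln (t / a)"
  have L: "L > 0" using a by (simp add: L_def)
  \<comment> \<open>This is \<open>x ^ n\<close> times the bound on the kernel; the division by
    \<open>L\<close> comes from the exponent \<open>real n * \<alpha> - 1\<close>.\<close>
  define b where "b n = (x * L powr \<alpha>) ^ n / Gamma (real n * \<alpha>) / (L * a)" for n
  have b0: "b \<longlonglongrightarrow> 0"
    unfolding b_def using x by (intro tendsto_divide_zero power_over_Gamma_tendsto_0 \<alpha>) simp
  have "(\<lambda>n. ennreal (b n) * (\<integral>\<^sup>+s. V s \<partial>lborel)) \<longlonglongrightarrow> ennreal 0 * (\<integral>\<^sup>+s. V s \<partial>lborel)"
    using fin by (intro ennreal_tendsto_cmult tendsto_ennrealI b0 tendsto_mult_ennreal tendsto_const) auto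
  then have lim: "(\<lambda>n. ennreal (b n) * (\<integral>\<^sup>+s. V s \<partial>lborel)) \<longlonglongrightarrow> 0" by simp
  have "eventually (\<lambda>n. ennreal (x ^ n) * (\<integral>\<^sup>+s. log_kernel (real n * \<alpha>) t s * V s \<partial>lborel)
      \<le> ennreal (b n) * (\<integral>\<^sup>+s. V s \<partial>lborel)) sequentially"
    using eventually_ge_at_top[of "nat \<lceil>1 / \<alpha>\<rceil>"]
  proof eventually_elim
    case (elim n)
    have "1 / \<alpha> \<le> real n" using elim by linarith
    then have n: "real n * \<alpha> \<ge> 1" using \<alpha> by (simp add: field_simps)
    then have G: "Gamma (real n * \<alpha>) > 0" by (intro Gamma_real_pos) auto
    have Ln: "L powr (real n * \<alpha> - 1) = (L powr \<alpha>) ^ n / L"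
      using L by (simp add: powr_diff powr_powr[symmetric] powr_realpow[symmetric] mult.commute[of _ \<alpha>])
    have bd: "ennreal (x ^ n) * log_kernel (real n * \<alpha>) t s * V s \<le> ennreal (b n) * V s" for s
    proof (cases "a < s \<and> s < t")
      case True
      have "ln (t / s) powr (real n * \<alpha> - 1) \<le> L powr (real n * \<alpha> - 1)"
        using True a n unfolding L_def by (intro powr_mono2) (auto simp: field_simps)
      then have "ln (t / s) powr (real n * \<alpha> - 1) / (Gamma (real n * \<alpha>) * s)
          \<le> L powr (real n * \<alpha> - 1) / (Gamma (real n * \<alpha>) * a)"
        using True a G by (intro frac_le) (auto intro!: mult_left_mono)
      then have "x ^ n * (ln (t / s) powr (real n * \<alpha> - 1) / (Gamma (real n * \<alpha>) * s)) \<le>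
          x ^ n * (L powr (real n * \<alpha> - 1) / (Gamma (real n * \<alpha>) * a))"
        using x by (intro mult_left_mono) auto
      also have "\<dots> = b n" by (simp add: Ln b_def power_mult_distrib)
      finally have "ennreal (x ^ n) * log_kernel (real n * \<alpha>) t s \<le> ennreal (b n)"
        using True a x by (simp add: log_kernel_def ennreal_mult'[symmetric] ennreal_leI)
      then show ?thesis by (intro mult_right_mono) auto
    next
      case False
      then show ?thesis using V0[of s] by (auto simp: log_kernel_def)
    qed
    have "ennreal (x ^ n) * (\<integral>\<^sup>+s. log_kernel (real n * \<alpha>) t s * V s \<partial>lborel)
        = (\<integral>\<^sup>+s. ennreal (x ^ n) * log_kernel (real n * \<alpha>) t s * V s \<partial>lborel)"
      by (subst nn_integral_cmult[symmetric]) (auto simp: mult.assoc)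
    also have "\<dots> \<le> (\<integral>\<^sup>+s. ennreal (b n) * V s \<partial>lborel)"
      by (intro nn_integral_mono bd)
    also have "\<dots> = ennreal (b n) * (\<integral>\<^sup>+s. V s \<partial>lborel)"
      by (intro nn_integral_cmult) auto
    finally show ?case .
  qed
  then show ?thesis
    by (intro tendsto_sandwich[OF _ _ tendsto_const lim]) auto
qed

section \<open>Iteration of the integral inequality\<close>

text \<open>Integrate the inequality against the kernel of order \<open>p\<close>; Tonelli moves the
  inner integral outside, and the semigroup law merges the two kernels. Only integrals are compared,
  so an inequality almost everywhere is enough.\<close>

lemma log_kernel_gronwall_step:
  fixes U V :: "real \<Rightarrow> ennreal"
  assumes \<alpha>: "\<alpha> > 0" and p: "p > 0"
    and [measurable]: "U \<in> borel_measurable borel" "V \<in> borel_measurable borel"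
    and ineq: "AE s in lborel. s < t \<longrightarrow> V s \<le> U s + x * (\<integral>\<^sup>+r. log_kernel \<alpha> s r * V r \<partial>lborel)"
  shows "(\<integral>\<^sup>+s. log_kernel p t s * V s \<partial>lborel) \<le>
    (\<integral>\<^sup>+s. log_kernel p t s * U s \<partial>lborel) + x * (\<integral>\<^sup>+s. log_kernel (p + \<alpha>) t s * V s \<partial>lborel)"
proof -
  have "(\<integral>\<^sup>+s. log_kernel p t s * V s \<partial>lborel) \<le>
      (\<integral>\<^sup>+s. log_kernel p t s * U s + x * (\<integral>\<^sup>+r. log_kernel p t s * log_kernel \<alpha> s r * V r \<partial>lborel) \<partial>lborel)"
  proof (rule nn_integral_mono_AE, use ineq in eventually_elim)
    case (elim s)
    show ?case
    proof (cases "s < t")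
      case True
      have "log_kernel p t s * V s \<le>
          log_kernel p t s * (U s + x * (\<integral>\<^sup>+r. log_kernel \<alpha> s r * V r \<partial>lborel))"
        using elim True by (intro mult_left_mono) auto
      also have "\<dots> = log_kernel p t s * U s + x * (log_kernel p t s * (\<integral>\<^sup>+r. log_kernel \<alpha> s r * V r \<partial>lborel))"
        by (simp add: algebra_simps)
      finally show ?thesis
        by (subst (asm) nn_integral_cmult[symmetric]) (auto simp: mult.assoc)
    qed (simp add: log_kernel_def)
  qed
  also have "\<dots> = (\<integral>\<^sup>+s. log_kernel p t s * U s \<partial>lborel) +
      x * (\<integral>\<^sup>+s. (\<integral>\<^sup>+r. log_kernel p t s * log_kernel \<alpha> s r * V r \<partial>lborel) \<partial>lborel)"
    by (subst nn_integral_add, measurable, subst nn_integral_cmult) auto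
  also have "(\<integral>\<^sup>+s. (\<integral>\<^sup>+r. log_kernel p t s * log_kernel \<alpha> s r * V r \<partial>lborel) \<partial>lborel) =
      (\<integral>\<^sup>+r. (\<integral>\<^sup>+s. log_kernel p t s * log_kernel \<alpha> s r * V r \<partial>lborel) \<partial>lborel)"
    by (rule lborel_pair.Fubini'[symmetric]) measurable
  also have "\<dots> = (\<integral>\<^sup>+r. log_kernel (p + \<alpha>) t r * V r \<partial>lborel)"
    by (subst nn_integral_multc) (auto simp: nn_integral_log_kernel_mult[OF p \<alpha>])
  finally show ?thesis .
qed

text \<open>The iteration starts with the integral term of order \<open>\<alpha>\<close> rather than
  with \<open>V t\<close>, because the step needs a positive order and a pointwise value of
  \<open>V\<close> carries no information.\<close>

lemma log_kernel_gronwall: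
  fixes U V :: "real \<Rightarrow> ennreal"
  assumes \<alpha>: "\<alpha> > 0" and a: "0 < a" "a < t" and x: "x \<ge> 0"
    and [measurable]: "U \<in> borel_measurable borel" "V \<in> borel_measurable borel"
    and fin: "(\<integral>\<^sup>+s. V s \<partial>lborel) < \<infinity>" and V0: "\<And>s. s \<le> a \<Longrightarrow> V s = 0"
    and ineq: "AE s in lborel. s < t \<longrightarrow>
      V s \<le> U s + ennreal x * (\<integral>\<^sup>+r. log_kernel \<alpha> s r * V r \<partial>lborel)"
  shows "ennreal x * (\<integral>\<^sup>+s. log_kernel \<alpha> t s * V s \<partial>lborel) \<le>
    (\<integral>\<^sup>+s. (\<Sum>n. ennreal (x ^ Suc n) * log_kernel (real (Suc n) * \<alpha>) t s * U s) \<partial>lborel)"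
proof -
  define w where "w W n = ennreal (x ^ n) * (\<integral>\<^sup>+s. log_kernel (real n * \<alpha>) t s * W s \<partial>lborel)"
    for W :: "real \<Rightarrow> ennreal" and n
  have step: "w V n \<le> w U n + w V (Suc n)" if "n > 0" for n
  proof -
    have "w V n \<le> ennreal (x ^ n) * ((\<integral>\<^sup>+s. log_kernel (real n * \<alpha>) t s * U s \<partial>lborel) +
        ennreal x * (\<integral>\<^sup>+s. log_kernel (real n * \<alpha> + \<alpha>) t s * V s \<partial>lborel))"
      unfolding w_def using that \<alpha> ineq
      by (intro mult_left_mono log_kernel_gronwall_step) auto
    then show ?thesis
      using x by (simp add: w_def distrib_left ennreal_mult ac_simps ring_class.ring_distribs distrib_right)
  qed
  have iter: "w V 1 \<le> (\<Sum>n<N. w U (Suc n)) + w V (Suc N)" for N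
  proof (induction N)
    case (Suc N)
    have "(\<Sum>n<N. w U (Suc n)) + w V (Suc N) \<le> (\<Sum>n<N. w U (Suc n)) + (w U (Suc N) + w V (Suc (Suc N)))"
      by (intro add_left_mono step) auto
    with Suc have "w V 1 \<le> (\<Sum>n<N. w U (Suc n)) + (w U (Suc N) + w V (Suc (Suc N)))"
      by (rule order_trans)
    then show ?case by (simp only: sum.lessThan_Suc add.assoc)
  qed simp
  \<comment> \<open>The partial sums are first enlarged to the full series, possibly infinite, so
    that only the remainder has to converge.\<close>
  have "(\<lambda>N. (\<Sum>n. w U (Suc n)) + w V (Suc N)) \<longlonglongrightarrow> (\<Sum>n. w U (Suc n)) + 0"
    unfolding w_def
    by (intro tendsto_add tendsto_const LIMSEQ_Suc log_kernel_integral_tendsto_0[OF \<alpha> a x _ fin V0]) auto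
  moreover have "w V 1 \<le> (\<Sum>n. w U (Suc n)) + w V (Suc N)" for N
    using iter[of N] by (rule order_trans) (auto intro!: add_right_mono sum_le_suminf)
  ultimately have "w V 1 \<le> (\<Sum>n. w U (Suc n))"
    by (intro LIMSEQ_le_const) auto
  also have "\<dots> = (\<Sum>n. \<integral>\<^sup>+s. ennreal (x ^ Suc n) * log_kernel (real (Suc n) * \<alpha>) t s * U s \<partial>lborel)"
    unfolding w_def by (subst nn_integral_cmult[symmetric]) (auto simp: mult.assoc)
  also have "\<dots> = (\<integral>\<^sup>+s. (\<Sum>n. ennreal (x ^ Suc n) * log_kernel (real (Suc n) * \<alpha>) t s * U s) \<partial>lborel)"
    by (rule nn_integral_suminf[symmetric]) measurable
  finally show ?thesis by (simp add: w_def)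
qed

section \<open>Borel representatives and the final inequality\<close>

text \<open>The given functions are only Lebesgue measurable, whereas Tonelli is applied on the
  Borel product. Changing \<open>f\<close> on a null set repairs this, and multiplying by the
  indicator makes \<open>F\<close> vanish at every point outside (a, t).\<close>

lemma absolutely_integrable_imp_AE_eq_borel:
  fixes f :: "real \<Rightarrow> real"
  assumes f: "f absolutely_integrable_on {a..t}" and nonneg: "\<And>s. s \<in> {a..t} \<Longrightarrow> f s \<ge> 0"
  obtains F :: "real \<Rightarrow> ennreal" where "F \<in> borel_measurable borel"
    "AE s in lborel. F s = ennreal (f s) * indicator {a<..<t} s"
    "\<And>s. s \<notin> {a<..<t} \<Longrightarrow> F s = 0" "(\<integral>\<^sup>+s. F s \<partial>lborel) < \<infinity>"
proof -
  have int: "integrable lebesgue (\<lambda>s. indicator {a..t} s *\<^sub>R f s)"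
    using f by (simp add: set_integrable_def)
  then have "(\<lambda>s. ennreal (indicator {a..t} s *\<^sub>R f s)) \<in> borel_measurable lebesgue"
    by measurable
  from completion_ex_borel_measurable[OF this]
  obtain G where [measurable]: "G \<in> borel_measurable lborel"
    and G: "AE s in lborel. ennreal (indicator {a..t} s *\<^sub>R f s) = G s" by blast
  define F where "F s = G s * indicator {a<..<t} s" for s
  have "(\<integral>\<^sup>+s. F s \<partial>lborel) \<le> (\<integral>\<^sup>+s. ennreal (norm (indicator {a..t} s *\<^sub>R f s)) \<partial>lborel)"
    by (rule nn_integral_mono_AE, use G in eventually_elim)
       (auto simp: F_def indicator_def abs_if ennreal_neg dest!: sym[of "ennreal _"])
  also have "\<dots> < \<infinity>"
    using int by (simp add: integrable_iff_bounded nn_integral_completion)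
  finally have "(\<integral>\<^sup>+s. F s \<partial>lborel) < \<infinity>" .
  moreover have "AE s in lborel. F s = ennreal (f s) * indicator {a<..<t} s"
    using G by eventually_elim (auto simp: F_def indicator_def split: if_splits)
  moreover have "F \<in> borel_measurable borel" unfolding F_def by measurable
  ultimately show ?thesis using that[of F] by (auto simp: F_def)
qed


theorem lemma3p2p1:
  fixes \<alpha> a C :: real and T :: ereal and I :: "real set" and u v \<psi> :: "real \<Rightarrow> real"
  defines "I \<equiv> {t. a \<le> t \<and> ereal t < T}"
  assumes "\<alpha> > 0" and "a > 0" and "ereal a < T"
    and "\<forall>t\<in>I. u t \<ge> 0" and "u locally_integrable_on I"
    and "\<forall>t\<in>I. \<psi> t \<ge> 0" and "mono_on I \<psi>" and "continuous_on I \<psi>"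
    and "\<forall>t\<in>I. \<psi> t \<le> C"
    and "\<forall>t\<in>I. v t \<ge> 0" and "v locally_integrable_on I"
    and "\<forall>t\<in>I. ennreal (v t) \<le> ennreal (u t) +
           ennreal (\<psi> t) *
           (\<integral>\<^sup>+\<tau>\<in>{a<..<t}. ennreal (ln (t / \<tau>) powr (\<alpha> - 1) * (v \<tau> / \<tau>)) \<partial>lebesgue)"
  shows "\<forall>t\<in>I. ennreal (v t) \<le> ennreal (u t) +
           (\<integral>\<^sup>+\<tau>\<in>{a<..<t}.
              (\<Sum>n. let k = Suc n in
                 ennreal ((\<psi> t * Gamma \<alpha>) ^ k / Gamma (real k * \<alpha>) *
                          ln (t / \<tau>) powr (real k * \<alpha> - 1) * (u \<tau> / \<tau>))) \<partial>lebesgue)"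
proof
  fix t assume tI: "t \<in> I"
  show "ennreal (v t) \<le> ennreal (u t) +
           (\<integral>\<^sup>+\<tau>\<in>{a<..<t}.
              (\<Sum>n. let k = Suc n in
                 ennreal ((\<psi> t * Gamma \<alpha>) ^ k / Gamma (real k * \<alpha>) *
                          ln (t / \<tau>) powr (real k * \<alpha> - 1) * (u \<tau> / \<tau>))) \<partial>lebesgue)"
  \<comment> \<open>For \<open>t = a\<close> the range of integration is empty, and the hypothesis
    already reads \<open>v t \<le> u t\<close>.\<close>
  proof (cases "a < t")
    case False
    then have "{a<..<t} = {}" by auto
    then show ?thesis using assms(13) tI by fastforce
  next
    case at: True
    have G: "Gamma \<alpha> > 0" using assms(2) by (rule Gamma_real_pos)
    have sub: "{a..t} \<subseteq> I"
      using tI by (auto simp: I_def intro: le_less_trans[of _ "ereal t"])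
    \<comment> \<open>The factor \<open>Gamma \<alpha>\<close> undoes the normalisation of
      \<open>log_kernel\<close>; since \<open>t\<close> is fixed, \<open>x\<close> is constant along
      the iteration.\<close>
    define x where "x = \<psi> t * Gamma \<alpha>"
    have x: "x \<ge> 0" using assms(7) tI G by (simp add: x_def)
    obtain U :: "real \<Rightarrow> ennreal" where U: "U \<in> borel_measurable borel"
      "AE s in lborel. U s = ennreal (u s) * indicator {a<..<t} s"
      by (rule absolutely_integrable_imp_AE_eq_borel[where f = u and a = a and t = t])
         (use assms(5,6) sub in \<open>auto simp: locally_integrable_on_def\<close>)
    obtain V :: "real \<Rightarrow> ennreal" where V: "V \<in> borel_measurable borel"
      "AE s in lborel. V s = ennreal (v s) * indicator {a<..<t} s"
      "\<And>s. s \<notin> {a<..<t} \<Longrightarrow> V s = 0" "(\<integral>\<^sup>+s. V s \<partial>lborel) < \<infinity>"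
      by (rule absolutely_integrable_imp_AE_eq_borel[where f = v and a = a and t = t])
         (use assms(11,12) sub in \<open>auto simp: locally_integrable_on_def\<close>)
    \<comment> \<open>Outside the integral \<open>u\<close> and \<open>v\<close> themselves are
      kept, so that the bound holds at every point, in particular at \<open>s = t\<close>; inside,
      the Borel representative \<open>V\<close> gives the same value.\<close>
    have ineq: "ennreal (v s) \<le> ennreal (u s) +
        ennreal x * (\<integral>\<^sup>+r. log_kernel \<alpha> s r * V r \<partial>lborel)" if s: "a \<le> s" "s \<le> t" for s
    proof -
      have sI: "s \<in> I" using s sub by auto
      have \<psi>: "\<psi> s \<le> \<psi> t" using assms(8) sI tI s by (auto simp: mono_on_def)
      have "ennreal (v s) \<le> ennreal (u s) + ennreal (\<psi> s) *
           (\<integral>\<^sup>+\<tau>\<in>{a<..<s}. ennreal (ln (s / \<tau>) powr (\<alpha> - 1) * (v \<tau> / \<tau>)) \<partial>lebesgue)"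
        using assms(13) sI by blast
      also have "(\<integral>\<^sup>+\<tau>\<in>{a<..<s}. ennreal (ln (s / \<tau>) powr (\<alpha> - 1) * (v \<tau> / \<tau>)) \<partial>lebesgue) =
          (\<integral>\<^sup>+r. ennreal (Gamma \<alpha>) * (log_kernel \<alpha> s r * V r) \<partial>lborel)"
        unfolding nn_integral_completion
      proof (rule nn_integral_cong_AE, use V(2) in eventually_elim)
        case (elim r)
        show ?case
        proof (cases "a < r \<and> r < s")
          case True
          with s have "r \<in> {a..t}" by simp
          with sub assms(11) have "0 \<le> v r" by blast
          with True elim s G assms(3) show ?thesis
            by (simp add: log_kernel_def ennreal_mult'[symmetric] ennreal_mult[symmetric])
        next
          case False
          then show ?thesis using V(3)[of r] by (auto simp: log_kernel_def)
        qed
      qed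
      also have "\<dots> = ennreal (Gamma \<alpha>) * (\<integral>\<^sup>+r. log_kernel \<alpha> s r * V r \<partial>lborel)"
        using V(1) by (intro nn_integral_cmult) measurable
      \<comment> \<open>Monotonicity of \<open>\<psi>\<close> replaces the varying coefficient by
        its value at \<open>t\<close>.\<close>
      also have "ennreal (\<psi> s) * \<dots> \<le> ennreal (\<psi> t) * \<dots>"
        using \<psi> by (intro mult_right_mono ennreal_leI) auto
      finally show ?thesis
        using G assms(7) tI by (simp add: x_def ennreal_mult mult.assoc add_left_mono)
    qed
    \<comment> \<open>Off (a, t) the left side is 0; inside, \<open>U\<close> and \<open>V\<close>
      agree almost everywhere with \<open>u\<close> and \<open>v\<close>.\<close>
    have AE: "AE s in lborel. s < t \<longrightarrow>
        V s \<le> U s + ennreal x * (\<integral>\<^sup>+r. log_kernel \<alpha> s r * V r \<partial>lborel)"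
      using U(2) V(2)
    proof eventually_elim
      case (elim s)
      show ?case
        using elim ineq[of s] V(3)[of s] by (cases "a < s \<and> s < t") auto
    qed
    have "ennreal (v t) \<le> ennreal (u t) + ennreal x * (\<integral>\<^sup>+r. log_kernel \<alpha> t r * V r \<partial>lborel)"
      using ineq at by simp
    also have "ennreal x * (\<integral>\<^sup>+r. log_kernel \<alpha> t r * V r \<partial>lborel) \<le>
        (\<integral>\<^sup>+s. (\<Sum>n. ennreal (x ^ Suc n) * log_kernel (real (Suc n) * \<alpha>) t s * U s) \<partial>lborel)"
      using V(3) by (intro log_kernel_gronwall[OF assms(2,3) at x U(1) V(1,4) _ AE]) auto
    also have "\<dots> = (\<integral>\<^sup>+\<tau>\<in>{a<..<t}.
              (\<Sum>n. let k = Suc n in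
                 ennreal ((\<psi> t * Gamma \<alpha>) ^ k / Gamma (real k * \<alpha>) *
                          ln (t / \<tau>) powr (real k * \<alpha> - 1) * (u \<tau> / \<tau>))) \<partial>lebesgue)"
      unfolding nn_integral_completion
    proof (rule nn_integral_cong_AE, use U(2) in eventually_elim)
      case (elim s)
      show ?case
      proof (cases "a < s \<and> s < t")
        case True
        then have "s \<in> {a..t}" by simp
        with assms(5) sub have us: "0 \<le> u s" by blast
        \<comment> \<open>The terms match one by one: the kernel supplies both 1 /
          \<open>Gamma (real k * \<alpha>)\<close> and 1 / \<open>s\<close>.\<close>
        have "ennreal (x ^ k) * log_kernel (real k * \<alpha>) t s * U s =
            ennreal ((\<psi> t * Gamma \<alpha>) ^ k / Gamma (real k * \<alpha>) *
              ln (t / s) powr (real k * \<alpha> - 1) * (u s / s))" if "k > 0" for k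
        proof -
          have "Gamma (real k * \<alpha>) > 0" using that assms(2) by (intro Gamma_real_pos) auto
          with True elim us x assms(3) show ?thesis
            by (simp add: log_kernel_def ennreal_mult'[symmetric] ennreal_mult[symmetric] x_def[symmetric] mult.assoc)
        qed
        with True show ?thesis by (simp add: Let_def del: of_nat_Suc power_Suc)
      next
        case False
        then show ?thesis using elim by simp
      qed
    qed
    finally show ?thesis by (simp add: add_left_mono)
  qed
qed

end
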